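(* Let $I\subseteq K[\mathbf{x}]=K[x_1,\ldots,x_n]$ be a zero dimensional ideal, i.e. $\dim_K(K[\mathbf{x}]/I)<\infty$. Let $G$ be a standard basis of $I$ with respect to the local ordering $\prec$ and let $\prec_2$ be another local ordering. Then the algorithm StandardBasisChange$(G,\prec,\prec_2)$ (described in the context) computes a standard basis of $I$ with respect to $\prec_2$.
   Context: $K$ is a field, $n\ge 1$, $\mathbb{N}=\{0,1,2,\ldots\}$, $\mathcal{M}=\{\mathbf{x}^{\alpha}\mid\alpha\in\mathbb{N}^n\}$ is the set of monomials, $\mathcal{T}=\{c\,\mathbf{x}^\alpha\mid c\in K\setminus\{0\}\}$ the set of terms. For a total ordering $\prec$ on $\mathcal{M}$ (not necessarily compatible with multiplication) and nonzero $f\in K[\mathbf{x}]$, $LM(f)$ is the $\prec$-largest monomial occurring in $f$ with nonzero coefficient. For a finite set $G\subset K[\mathbf{x}]$, $L(G)=\{LM(\mathbf{x}^\alpha g)\mid \mathbf{x}^\alpha\in\mathcal{M}, g\in G\}$; for an ideal $I$, $L(I)=\{LM(g)\mid g\in I\}$ (nonzero $g$ only). $\prec$ is normal if for all nonzero $f$ and all $\mathbf{x}^\alpha\in\mathcal{M}$: $\mathbf{x}^\alpha\prec 1\Rightarrow LM(\mathbf{x}^\alpha f)\prec LM(f)$. A local ordering is a normal ordering with $x_i\prec1$ for $1\le i\le n$. For a local ordering, $S_\prec=\{g\in K[\mathbf{x}]\mid LM(g)=1\}$ is multiplicatively closed with $S_\prec^{-1}K[\mathbf{x}]=K[\mathbf{x}]_{(x_1,\ldots,x_n)}$;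 put $\overline{I}=S_\prec^{-1}I\cap K[\mathbf{x}]$ (the same for all local orderings). A standard basis of $I$ with respect to $\prec$ is a finite set $G\subseteq\overline{I}$ with $L(G)=L(I)$. Algorithm StandardBasisChange$(G,\prec,\prec_2)$: 1. $Z_{gen}:=\mathrm{ComputeZgen}(G,\prec)$, a procedure returning a (reduced, finite) set of monomial generators of some monomial ideal contained in $\overline{I}$ which contains a power of $(x_1,\ldots,x_n)$. 2. $M:=\{\mathbf{x}^\alpha\in\mathcal{M}\mid\mathbf{x}^\alpha\notin(Z_{gen})\}$ (a finite set), $N:=\{\mathbf{x}^\alpha\in M\mid\mathbf{x}^\alpha\notin L(G)\}$, $H:=M\setminus N$, where $L(G)$ is taken with respect to $\prec$. 3. $F:=\emptyset$; for every $\mathbf{x}^\alpha\in H$ choose the first $f\in G$ with $LM(\eta f)=\mathbf{x}^\alpha$ (with respect to $\prec$) for some $\eta\in\mathcal{T}$, and put $F:=F\cup\{\eta f\}$. 4. $A:=$ the matrix of coefficients of all $f\in F$ with respect to the monomials of $M$ (one row for each $f\in F$; coefficients of monomials outside $M$ are ignored), with columns sorted by $\prec_2$, in decreasing order. 5. $A:=$ the matrix obtained from $A$ by Gaussian elimination (reduced row echelon form). 6. $F:=$ the set of entries of the vector obtained by multiplying $A$ with the column vector of the elements of $M$ sorted in the same way by $\prec_2$. 7. Output $F\cup Z_{gen}$. *)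

theory Defs
  imports
    "HOL-Library.Poly_Mapping"
    "HOL-Computational_Algebra.Fraction_Field"
    "Jordan_Normal_Form.Gauss_Jordan_Elimination"
begin

text \<open>
  The finite type \<open>'n\<close> indexes the variables, so \<open>n = CARD('n) \<ge> 1\<close>. A monomial is represented by its
  exponent \<open>\<alpha> :: 'n \<Rightarrow>\<^sub>0 nat\<close>, and the monomial \<open>1\<close> by \<open>0\<close>. The sort \<open>linorder\<close> on \<open>'n\<close> (variables are
  numbered) is only there because the library's \<open>idom\<close> instance for polynomials asks for it;
  it is unrelated to the monomial orderings, which are arbitrary relations \<open>\<prec>\<close>.
\<close>

type_synonym 'n expo = "'n \<Rightarrow>\<^sub>0 nat"
type_synonym ('n, 'k) mpol = "('n \<Rightarrow>\<^sub>0 nat) \<Rightarrow>\<^sub>0 'k"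
type_synonym 'n mord = "'n expo \<Rightarrow> 'n expo \<Rightarrow> bool"

definition xpow :: "'n expo \<Rightarrow> ('n, 'k::field) mpol" where
  "xpow \<alpha> = Poly_Mapping.single \<alpha> 1"

definition const :: "'k \<Rightarrow> ('n, 'k::field) mpol" where
  "const c = Poly_Mapping.single 0 c"

definition pvar :: "'n \<Rightarrow> 'n expo" where
  "pvar i = Poly_Mapping.single i 1"

definition terms :: "('n, 'k::field) mpol set" where
  "terms = {const c * xpow \<alpha> | c \<alpha>. c \<noteq> 0}"


subsection \<open>Ideals\<close>

definition is_ideal :: "'a::comm_ring_1 set \<Rightarrow> bool" where
  "is_ideal I \<longleftrightarrow> Modules.module.subspace (*) I"

definition ideal_gen :: "'a::comm_ring_1 set \<Rightarrow> 'a set" where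
  "ideal_gen S = Modules.module.span (*) S"

primrec ideal_power :: "'a::comm_ring_1 set \<Rightarrow> nat \<Rightarrow> 'a set" where
  "ideal_power J 0 = UNIV"
| "ideal_power J (Suc k) = ideal_gen {a * b | a b. a \<in> J \<and> b \<in> ideal_power J k}"

definition var_ideal :: "('n, 'k::field) mpol set" where
  "var_ideal = ideal_gen (range (\<lambda>i. xpow (pvar i)))"

text \<open>\<open>K[x]/I\<close> is finite dimensional: it is spanned over \<open>K\<close> by the classes of finitely many \<open>b \<in> B\<close>.\<close>

definition zero_dimensional :: "('n, 'k::field) mpol set \<Rightarrow> bool" where
  "zero_dimensional I \<longleftrightarrow>
     (\<exists>B. finite B \<and> (\<forall>f. \<exists>c. f - (\<Sum>b\<in>B. const (c b) * b) \<in> I))"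


subsection \<open>Orderings and leading monomials\<close>

text \<open>\<open>LM\<close> is meaningful only for \<open>f \<noteq> 0\<close>; every use below is guarded accordingly.\<close>

definition LM :: "'n mord \<Rightarrow> ('n, 'k::field) mpol \<Rightarrow> 'n expo" where
  "LM lt f = (THE \<alpha>. \<alpha> \<in> Poly_Mapping.keys f \<and> (\<forall>\<beta>\<in>Poly_Mapping.keys f. \<beta> \<noteq> \<alpha> \<longrightarrow> lt \<beta> \<alpha>))"

definition total_ordering :: "'n mord \<Rightarrow> bool" where
  "total_ordering lt \<longleftrightarrow> transp lt \<and> irreflp lt \<and> totalp lt"

definition normal_ordering :: "'k::field itself \<Rightarrow> 'n mord \<Rightarrow> bool" where
  "normal_ordering _ lt \<longleftrightarrow> total_ordering lt \<and>
     (\<forall>(f :: ('n, 'k) mpol) \<alpha>. f \<noteq> 0 \<longrightarrow> lt \<alpha> 0 \<longrightarrow> lt (LM lt (xpow \<alpha> * f)) (LM lt f))"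

definition local_ordering :: "'k::field itself \<Rightarrow> 'n mord \<Rightarrow> bool" where
  "local_ordering k lt \<longleftrightarrow> normal_ordering k lt \<and> (\<forall>i. lt (pvar i) 0)"


subsection \<open>Standard bases\<close>

definition L_gens :: "'n mord \<Rightarrow> ('n, 'k::field) mpol set \<Rightarrow> 'n expo set" where
  "L_gens lt G = {LM lt (xpow \<alpha> * g) | \<alpha> g. g \<in> G \<and> g \<noteq> 0}"

definition L_ideal :: "'n mord \<Rightarrow> ('n, 'k::field) mpol set \<Rightarrow> 'n expo set" where
  "L_ideal lt I = {LM lt g | g. g \<in> I \<and> g \<noteq> 0}"

definition S_lt :: "'n mord \<Rightarrow> ('n, 'k::field) mpol set" where
  "S_lt lt = {g. g \<noteq> 0 \<and> LM lt g = 0}"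

text \<open>\<open>S\<^sup>-\<^sup>1 I\<close> lives in the field of fractions of \<open>K[x]\<close>, and \<open>K[x]\<close> embeds by \<open>f \<mapsto> f/1\<close>.\<close>

definition localized :: "'n mord \<Rightarrow> ('n::linorder, 'k::field) mpol set \<Rightarrow> ('n, 'k) mpol fract set" where
  "localized lt I = {Fraction_Field.Fract a s | a s. a \<in> I \<and> s \<in> S_lt lt}"

definition Ibar :: "'n mord \<Rightarrow> ('n::linorder, 'k::field) mpol set \<Rightarrow> ('n, 'k) mpol set" where
  "Ibar lt I = {f. Fraction_Field.Fract f 1 \<in> localized lt I}"

definition standard_basis ::
  "'n mord \<Rightarrow> ('n::linorder, 'k::field) mpol set \<Rightarrow> ('n, 'k) mpol set \<Rightarrow> bool" where
  "standard_basis lt I G \<longleftrightarrow> finite G \<and> G \<subseteq> Ibar lt I \<and> L_gens lt G = L_ideal lt I"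


subsection \<open>The algorithm\<close>

text \<open>The contract of \<open>ComputeZgen\<close>; \<open>Z\<close> consists of exponents, and reduced means that no generator
  divides another one.\<close>

definition valid_Zgen :: "'n mord \<Rightarrow> ('n::linorder, 'k::field) mpol set \<Rightarrow> 'n expo set \<Rightarrow> bool" where
  "valid_Zgen lt I Z \<longleftrightarrow> finite Z \<and>
     (\<forall>\<alpha>\<in>Z. \<forall>\<beta>\<in>Z. \<alpha> \<noteq> \<beta> \<longrightarrow> \<not> (xpow \<alpha> :: ('n, 'k) mpol) dvd xpow \<beta>) \<and>
     ideal_gen (xpow ` Z) \<subseteq> Ibar lt I \<and>
     (\<exists>k. ideal_power (var_ideal :: ('n, 'k) mpol set) k \<subseteq> ideal_gen (xpow ` Z))"

text \<open>
  \<open>standard_basis_change computeZgen G lt lt2 R\<close>: some run of the algorithm outputs \<open>R\<close>.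
  It is a relation because the algorithm leaves open the choice of the terms \<open>\<eta>\<close> and the order
  of the rows of the matrix. \<open>G\<close> is a list since the first suitable element of it is to be chosen.
  The list \<open>cols\<close> is \<open>M\<close> sorted in decreasing order with respect to \<open>lt2\<close>; its existence entails
  that \<open>M\<close> is finite. The function \<open>gauss_jordan_single\<close> yields the reduced row echelon form
  (the library predicate \<open>row_echelon_form\<close> asks for pivots \<open>1\<close> and zeros above and below them).
\<close>

definition standard_basis_change ::
  "(('n, 'k::field) mpol list \<Rightarrow> 'n mord \<Rightarrow> 'n expo set) \<Rightarrow> ('n, 'k) mpol list \<Rightarrow>
    'n mord \<Rightarrow> 'n mord \<Rightarrow> ('n, 'k) mpol set \<Rightarrow> bool" where
  "standard_basis_change computeZgen G lt lt2 R \<longleftrightarrow>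
    (let Zgen = computeZgen G lt;
         M = {\<alpha>. (xpow \<alpha> :: ('n, 'k) mpol) \<notin> ideal_gen (xpow ` Zgen)};
         N = {\<alpha> \<in> M. \<alpha> \<notin> L_gens lt (set G)};
         H = M - N
     in \<exists>f \<eta> rows cols.
          (\<forall>\<alpha>\<in>H. find (\<lambda>g. g \<noteq> 0 \<and> (\<exists>\<theta>\<in>terms. LM lt (\<theta> * g) = \<alpha>)) G = Some (f \<alpha>) \<and>
                  \<eta> \<alpha> \<in> terms \<and> LM lt (\<eta> \<alpha> * f \<alpha>) = \<alpha>) \<and>
          distinct rows \<and> set rows = (\<lambda>\<alpha>. \<eta> \<alpha> * f \<alpha>) ` H \<and>
          sorted_wrt (\<lambda>\<alpha> \<beta>. lt2 \<beta> \<alpha>) cols \<and> set cols = M \<and>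
          (let A = mat (length rows) (length cols) (\<lambda>(i, j). Poly_Mapping.lookup (rows ! i) (cols ! j));
               A' = gauss_jordan_single A;
               F = set\<^sub>v (map_mat const A' *\<^sub>v vec_of_list (map xpow cols))
           in R = F \<union> xpow ` Zgen))"

end

theory Submission
  imports Defs
begin

text \<open>
  Let \<open>J\<close> be the monomial ideal generated by \<open>Zgen\<close> and \<open>M\<close> the finite set of monomials outside it.

  For a normal ordering with \<open>x\<^sub>i \<prec> 1\<close>, multiplying \<open>f\<close> by a polynomial with nonzero constant term does
  not change its leading monomial, because every other term of the factor pushes \<open>f\<close> strictly
  down (\<open>LM_unit_mult\<close>). So \<open>S\<close> is the set of polynomials with nonzero constant term,
  whatever the local ordering; the closure of \<open>I\<close> is an ideal common to all
  local orderings, and it has the same leading monomials as \<open>I\<close> (\<open>L_ideal_Ibar\<close>). Everything can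
  therefore be done in the closure, which contains \<open>J\<close>: discarding the terms of a polynomial that lie
  outside \<open>M\<close> does not leave the closure.

  This reduces the claim to linear algebra in the finite dimensional space \<open>K[M]\<close> spanned by \<open>M\<close>. Let
  \<open>V\<close> be the part of the closure that is supported on \<open>M\<close>. The rows chosen from \<open>G\<close>, truncated to \<open>M\<close>, lie in
  \<open>V\<close>, and by the standard basis property for \<open>\<prec>\<close> every nonzero element of \<open>V\<close> shares its leading
  monomial with one of them; cancelling leading terms repeatedly, they span \<open>V\<close>
  (\<open>span_if_LM_covered\<close>). Gaussian elimination keeps the row space, and since the columns
  are sorted by \<open>\<prec>\<^sub>2\<close>, every nonzero element of the space has the same \<open>\<prec>\<^sub>2\<close>-leading monomial as some row of
  the echelon form (\<open>LM_row_space_echelon\<close>). Hence the output rows realise all \<open>\<prec>\<^sub>2\<close>-leading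
  monomials in \<open>M\<close>, and the multiples of \<open>Zgen\<close> realise those outside \<open>M\<close>.
\<close>

section \<open>Polynomials, ideals and leading monomials\<close>

abbreviation coeff :: "('n, 'k::field) mpol \<Rightarrow> 'n expo \<Rightarrow> 'k" where
  "coeff \<equiv> Poly_Mapping.lookup"

abbreviation supp :: "('n, 'k::field) mpol \<Rightarrow> 'n expo set" where
  "supp \<equiv> Poly_Mapping.keys"

lemma const_mult_xpow: "const c * xpow \<alpha> = Poly_Mapping.single \<alpha> c"
  by (simp add: const_def xpow_def mult_single)

lemma coeff_single_mult: "coeff (Poly_Mapping.single \<alpha> c * f) (\<alpha> + \<beta>) = c * coeff f \<beta>"
  by (simp add: lookup_mult lookup_single when_mult)

lemma coeff_const_mult: "coeff (const c * f) \<beta> = c * coeff f \<beta>"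
  using coeff_single_mult[of 0 c f \<beta>] by (simp add: const_def)

lemma xpow_mult_xpow: "xpow \<alpha> * xpow \<beta> = xpow (\<alpha> + \<beta>)"
  by (simp add: xpow_def mult_single)

lemma supp_xpow: "supp (xpow \<alpha> :: ('n, 'k::field) mpol) = {\<alpha>}"
  by (simp add: xpow_def)

lemma xpow_nonzero: "(xpow \<alpha> :: ('n, 'k::field) mpol) \<noteq> 0"
  by (metis supp_xpow keys_zero insert_not_empty)

lemma sum_of_monomials: "f = (\<Sum>\<beta>\<in>supp f. Poly_Mapping.single \<beta> (coeff f \<beta>))"
  by (rule poly_mapping_eqI)
    (simp add: lookup_sum lookup_single when_def in_keys_iff)

lemma module_mult: "Modules.module ((*) :: 'a::comm_ring_1 \<Rightarrow> 'a \<Rightarrow> 'a)"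
  by standard (simp_all add: algebra_simps)

lemma is_ideal_iff:
  "is_ideal I \<longleftrightarrow> 0 \<in> I \<and> (\<forall>x\<in>I. \<forall>y\<in>I. x + y \<in> I) \<and> (\<forall>c. \<forall>x\<in>I. c * x \<in> I)"
  by (simp add: is_ideal_def Modules.module.subspace_def[OF module_mult])

lemma is_ideal_diff: "is_ideal I \<Longrightarrow> x \<in> I \<Longrightarrow> y \<in> I \<Longrightarrow> x - y \<in> I"
  unfolding is_ideal_def by (rule Modules.module.subspace_diff[OF module_mult])

lemma is_ideal_sum: "is_ideal I \<Longrightarrow> (\<And>x. x \<in> A \<Longrightarrow> g x \<in> I) \<Longrightarrow> sum g A \<in> I"
  unfolding is_ideal_def by (rule Modules.module.subspace_sum[OF module_mult])

lemma is_ideal_mult: "is_ideal I \<Longrightarrow> x \<in> I \<Longrightarrow> c * x \<in> I"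
  by (simp add: is_ideal_iff)

lemma is_ideal_ideal_gen: "is_ideal (ideal_gen S)"
  unfolding is_ideal_def ideal_gen_def by (rule Modules.module.subspace_span[OF module_mult])

lemma ideal_gen_superset: "x \<in> S \<Longrightarrow> x \<in> ideal_gen S"
  unfolding ideal_gen_def by (rule Modules.module.span_base[OF module_mult])

lemma ideal_gen_minimal: "S \<subseteq> I \<Longrightarrow> is_ideal I \<Longrightarrow> ideal_gen S \<subseteq> I"
  unfolding ideal_gen_def is_ideal_def by (rule Modules.module.span_minimal[OF module_mult])

lemma total_ordering_trans: "total_ordering lt \<Longrightarrow> lt a b \<Longrightarrow> lt b c \<Longrightarrow> lt a c"
  unfolding total_ordering_def transp_def by blast

lemma total_ordering_irrefl: "total_ordering lt \<Longrightarrow> \<not> lt a a"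
  unfolding total_ordering_def irreflp_def by blast

lemma total_ordering_total: "total_ordering lt \<Longrightarrow> a \<noteq> b \<Longrightarrow> lt a b \<or> lt b a"
  unfolding total_ordering_def totalp_on_def by blast

lemma LM_eqI:
  assumes "total_ordering lt" "\<alpha> \<in> supp f" "\<And>\<beta>. \<beta> \<in> supp f \<Longrightarrow> \<beta> \<noteq> \<alpha> \<Longrightarrow> lt \<beta> \<alpha>"
  shows "LM lt f = \<alpha>"
  unfolding LM_def
proof (rule the_equality)
  fix \<gamma> assume \<gamma>: "\<gamma> \<in> supp f \<and> (\<forall>\<beta>\<in>supp f. \<beta> \<noteq> \<gamma> \<longrightarrow> lt \<beta> \<gamma>)"
  then show "\<gamma> = \<alpha>"
    using assms(2,3) total_ordering_trans[OF assms(1)] total_ordering_irrefl[OF assms(1)]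
    by metis
qed (use assms in blast)

lemma total_ordering_finite_max:
  assumes "total_ordering lt" "finite A" "A \<noteq> {}"
  shows "\<exists>\<alpha>\<in>A. \<forall>\<beta>\<in>A. \<beta> \<noteq> \<alpha> \<longrightarrow> lt \<beta> \<alpha>"
  using assms(2,3)
proof (induction rule: finite_ne_induct)
  case (insert a A)
  then obtain \<alpha> where \<alpha>: "\<alpha> \<in> A" "\<forall>\<beta>\<in>A. \<beta> \<noteq> \<alpha> \<longrightarrow> lt \<beta> \<alpha>" by blast
  show ?case
    using \<alpha> total_ordering_total[OF assms(1), of a \<alpha>] total_ordering_trans[OF assms(1)]
    by (metis insert_iff)
qed auto

lemma LM_props:
  assumes "total_ordering lt" "f \<noteq> 0"
  shows "LM lt f \<in> supp f" "\<beta> \<in> supp f \<Longrightarrow> \<beta> \<noteq> LM lt f \<Longrightarrow> lt \<beta> (LM lt f)"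
proof -
  have "supp f \<noteq> {}" using assms(2) by simp
  then obtain \<alpha> where \<alpha>: "\<alpha> \<in> supp f" "\<forall>\<beta>\<in>supp f. \<beta> \<noteq> \<alpha> \<longrightarrow> lt \<beta> \<alpha>"
    using total_ordering_finite_max[OF assms(1), of "supp f"] by auto
  then have "LM lt f = \<alpha>" using LM_eqI[OF assms(1)] by blast
  with \<alpha> show "LM lt f \<in> supp f" "\<beta> \<in> supp f \<Longrightarrow> \<beta> \<noteq> LM lt f \<Longrightarrow> lt \<beta> (LM lt f)" by auto
qed

lemma LM_xpow: "total_ordering lt \<Longrightarrow> LM lt (xpow \<alpha> :: ('n, 'k::field) mpol) = \<alpha>"
  by (rule LM_eqI) (auto simp: supp_xpow)

lemma coeff_above_LM:
  assumes "total_ordering lt" "lt (LM lt f) \<beta>"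
  shows "coeff f \<beta> = 0"
proof (rule ccontr)
  assume "coeff f \<beta> \<noteq> 0"
  then have "\<beta> \<in> supp f" "f \<noteq> 0" by (auto simp: in_keys_iff)
  with LM_props(2)[OF assms(1), of f \<beta>] show False
    using assms total_ordering_trans[OF assms(1)] total_ordering_irrefl[OF assms(1)] by metis
qed


section \<open>Local orderings and the closure of an ideal\<close>

lemma local_ordering_total: "local_ordering TYPE('k::field) lt \<Longrightarrow> total_ordering lt"
  by (simp add: local_ordering_def normal_ordering_def)

lemma local_ordering_normal:
  fixes f :: "('n, 'k::field) mpol"
  assumes "local_ordering TYPE('k) lt" "f \<noteq> 0" "lt \<alpha> 0"
  shows "lt (LM lt (xpow \<alpha> * f)) (LM lt f)"
  using assms unfolding local_ordering_def normal_ordering_def by simp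

text \<open>
  Normality applied to a monomial \<open>x\<^sup>\<beta>\<close> gives \<open>x\<^sub>i x\<^sup>\<beta> \<prec> x\<^sup>\<beta>\<close>. Starting from \<open>1\<close> and multiplying by one
  variable at a time, one therefore descends strictly to any other monomial.
\<close>

lemma local_ordering_less_0:
  fixes lt :: "'n mord"
  assumes lt: "local_ordering TYPE('k::field) lt" and "\<alpha> \<noteq> 0"
  shows "lt \<alpha> 0"
proof -
  note tot = local_ordering_total[OF lt]
  have var: "lt (pvar i + \<beta>) \<beta>" for i \<beta>
    using local_ordering_normal[OF lt, of "xpow \<beta>" "pvar i"] lt
    by (simp add: xpow_mult_xpow LM_xpow[OF tot] xpow_nonzero local_ordering_def)
  have mult: "\<beta> = 0 \<or> lt \<beta> 0 \<Longrightarrow> lt (Poly_Mapping.single i (Suc m) + \<beta>) 0" for i m \<beta>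
  proof (induction m)
    case 0
    then show ?case using var[of i \<beta>] total_ordering_trans[OF tot] by (auto simp: pvar_def)
  next
    case (Suc m)
    have "Poly_Mapping.single i (Suc (Suc m)) + \<beta> = pvar i + (Poly_Mapping.single i (Suc m) + \<beta>)"
      unfolding pvar_def by (simp add: single_add[symmetric] add.assoc[symmetric])
    then show ?case using Suc var total_ordering_trans[OF tot] by metis
  qed
  have "\<alpha> = 0 \<or> lt \<alpha> 0"
  proof (induction \<alpha> rule: update_induct)
    case (update f a b)
    have "Poly_Mapping.update a b f = Poly_Mapping.single a b + f"
      using update(1)
      by (intro poly_mapping_eqI)
        (auto simp: lookup_update lookup_add lookup_single in_keys_iff when_def)
    moreover obtain m where "b = Suc m" using update(2) by (cases b) auto
    ultimately show ?case using mult update(3) by metis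
  qed auto
  with assms(2) show ?thesis by simp
qed

text \<open>
  Write \<open>s = c + t\<close> with \<open>c \<noteq> 0\<close> constant and \<open>t\<close> without constant term. By normality each monomial
  of \<open>t\<close>, being below \<open>1\<close>, moves all of \<open>f\<close> strictly below \<open>LM f\<close>, so at \<open>LM f\<close> and above, \<open>s * f\<close> agrees
  with \<open>c * f\<close>. Normality thus stands in for compatibility with multiplication.
\<close>

lemma LM_unit_mult:
  fixes f s :: "('n, 'k::field) mpol"
  assumes lt: "local_ordering TYPE('k) lt" and s: "coeff s 0 \<noteq> 0" and f: "f \<noteq> 0"
  shows "s * f \<noteq> 0" "LM lt (s * f) = LM lt f"
proof -
  note tot = local_ordering_total[OF lt]
  let ?\<mu> = "LM lt f"
  have small: "coeff (Poly_Mapping.single \<alpha> c * f) \<beta> = 0"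
    if "\<alpha> \<noteq> 0" "\<beta> = ?\<mu> \<or> lt ?\<mu> \<beta>" for \<alpha> c \<beta>
  proof -
    have "lt (LM lt (xpow \<alpha> * f)) \<beta>"
      using local_ordering_normal[OF lt f local_ordering_less_0[OF lt that(1)]] that(2)
        total_ordering_trans[OF tot] by metis
    then have "coeff (xpow \<alpha> * f) \<beta> = 0" by (rule coeff_above_LM[OF tot])
    then show ?thesis
      unfolding const_mult_xpow[symmetric] mult.assoc coeff_const_mult by simp
  qed
  have big: "coeff (s * f) \<beta> = coeff s 0 * coeff f \<beta>" if \<beta>: "\<beta> = ?\<mu> \<or> lt ?\<mu> \<beta>" for \<beta>
  proof -
    have "s * f = (\<Sum>\<alpha>\<in>supp s. Poly_Mapping.single \<alpha> (coeff s \<alpha>) * f)"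
      using arg_cong[OF sum_of_monomials[of s], of "\<lambda>t. t * f"] by (simp add: sum_distrib_right)
    then have "coeff (s * f) \<beta> = (\<Sum>\<alpha>\<in>supp s. coeff (Poly_Mapping.single \<alpha> (coeff s \<alpha>) * f) \<beta>)"
      by (simp add: lookup_sum)
    also have "\<dots> = (\<Sum>\<alpha>\<in>{0}. coeff (Poly_Mapping.single \<alpha> (coeff s \<alpha>) * f) \<beta>)"
      using s small[OF _ \<beta>] by (intro sum.mono_neutral_right) (auto simp: in_keys_iff)
    finally show ?thesis using coeff_single_mult[of 0 "coeff s 0" f \<beta>] by simp
  qed
  have mem: "?\<mu> \<in> supp (s * f)"
    using big[of ?\<mu>] s LM_props(1)[OF tot f] by (simp add: in_keys_iff)
  then show "s * f \<noteq> 0" by auto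
  show "LM lt (s * f) = ?\<mu>"
  proof (rule LM_eqI[OF tot mem], rule ccontr)
    fix \<beta> assume \<beta>: "\<beta> \<in> supp (s * f)" "\<beta> \<noteq> ?\<mu>" "\<not> lt \<beta> ?\<mu>"
    then have "lt ?\<mu> \<beta>" using total_ordering_total[OF tot] by blast
    then have "coeff (s * f) \<beta> = 0" using big coeff_above_LM[OF tot, of f \<beta>] by simp
    with \<beta>(1) show False by (simp add: in_keys_iff)
  qed
qed

lemma S_lt_iff:
  fixes s :: "('n, 'k::field) mpol"
  assumes lt: "local_ordering TYPE('k) lt"
  shows "s \<in> S_lt lt \<longleftrightarrow> coeff s 0 \<noteq> 0"
proof
  note tot = local_ordering_total[OF lt]
  assume "s \<in> S_lt lt"
  then show "coeff s 0 \<noteq> 0"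
    using LM_props(1)[OF tot, of s] by (auto simp: S_lt_def in_keys_iff)
next
  note tot = local_ordering_total[OF lt]
  assume "coeff s 0 \<noteq> 0"
  then show "s \<in> S_lt lt"
    using LM_unit_mult[OF lt, of s 1] LM_xpow[OF tot, of 0, where 'k = 'k]
    by (auto simp: S_lt_def xpow_def)
qed

text \<open>
  Clearing denominators. The right-hand side refers only to constant terms, which makes the closure
  independent of the local ordering.
\<close>

lemma mem_Ibar_iff:
  fixes I :: "('n::linorder, 'k::field) mpol set"
  assumes lt: "local_ordering TYPE('k) lt"
  shows "f \<in> Ibar lt I \<longleftrightarrow> (\<exists>s. coeff s 0 \<noteq> 0 \<and> s * f \<in> I)"
proof -
  have nz: "s \<noteq> 0" if "coeff s 0 \<noteq> 0" for s :: "('n, 'k) mpol" using that by auto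
  have eq: "Fraction_Field.Fract f 1 = Fraction_Field.Fract a s \<longleftrightarrow> a = s * f" if "coeff s 0 \<noteq> 0" for a s
    using nz[OF that] by (auto simp: eq_fract mult.commute)
  show ?thesis
  proof
    assume "f \<in> Ibar lt I"
    then obtain a s where "Fraction_Field.Fract f 1 = Fraction_Field.Fract a s" "a \<in> I" "coeff s 0 \<noteq> 0"
      by (auto simp: Ibar_def localized_def S_lt_iff[OF lt])
    then show "\<exists>s. coeff s 0 \<noteq> 0 \<and> s * f \<in> I" using eq by auto
  next
    assume "\<exists>s. coeff s 0 \<noteq> 0 \<and> s * f \<in> I"
    then obtain s where s: "coeff s 0 \<noteq> 0" "s * f \<in> I" by blast
    then have "Fraction_Field.Fract f 1 = Fraction_Field.Fract (s * f) s" using eq by simp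
    then show "f \<in> Ibar lt I" using s unfolding Ibar_def localized_def S_lt_iff[OF lt, symmetric] by blast
  qed
qed

lemma Ibar_local_ordering_indep:
  fixes I :: "('n::linorder, 'k::field) mpol set"
  assumes "local_ordering TYPE('k) lt" "local_ordering TYPE('k) lt2"
  shows "Ibar lt2 I = Ibar lt I"
  by (rule Set.set_eqI) (simp add: mem_Ibar_iff[OF assms(1)] mem_Ibar_iff[OF assms(2)])

lemma is_ideal_Ibar:
  fixes I :: "('n::linorder, 'k::field) mpol set"
  assumes lt: "local_ordering TYPE('k) lt" and I: "is_ideal I"
  shows "is_ideal (Ibar lt I)"
  unfolding is_ideal_iff mem_Ibar_iff[OF lt] Ball_def
proof (intro conjI allI impI; (elim exE conjE)?)
  show "\<exists>s. coeff s 0 \<noteq> 0 \<and> s * 0 \<in> I"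
    using I by (intro exI[of _ 1]) (simp add: is_ideal_iff)
next
  fix x y s t :: "('n, 'k) mpol"
  assume s: "coeff s 0 \<noteq> 0" "s * x \<in> I" and t: "coeff t 0 \<noteq> 0" "t * y \<in> I"
  \<comment> \<open>The product of the two denominators has leading monomial \<open>1\<close>, hence a constant term.\<close>
  have "s * t \<in> S_lt lt"
    using LM_unit_mult[OF lt s(1), of t] t(1) S_lt_iff[OF lt, of t] by (auto simp: S_lt_def)
  then have "coeff (s * t) 0 \<noteq> 0" by (simp add: S_lt_iff[OF lt])
  moreover have "(s * t) * (x + y) = t * (s * x) + s * (t * y)" by (simp add: algebra_simps)
  moreover have "\<dots> \<in> I" using I s(2) t(2) by (simp add: is_ideal_iff)
  ultimately show "\<exists>u. coeff u 0 \<noteq> 0 \<and> u * (x + y) \<in> I" by metis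
next
  fix c x s :: "('n, 'k) mpol"
  assume s: "coeff s 0 \<noteq> 0" "s * x \<in> I"
  have "s * (c * x) = c * (s * x)" by (simp add: algebra_simps)
  then show "\<exists>s. coeff s 0 \<noteq> 0 \<and> s * (c * x) \<in> I" using s is_ideal_mult[OF I] by metis
qed

text \<open>
  An element \<open>f\<close> of the closure has a multiple \<open>s * f\<close> in \<open>I\<close> with \<open>s\<close> a unit at the origin, and
  \<open>s * f\<close> has the same leading monomial as \<open>f\<close>.
\<close>

lemma L_ideal_Ibar:
  fixes I :: "('n::linorder, 'k::field) mpol set"
  assumes lt: "local_ordering TYPE('k) lt"
  shows "L_ideal lt (Ibar lt I) = L_ideal lt I"
proof
  show "L_ideal lt (Ibar lt I) \<subseteq> L_ideal lt I"
  proof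
    fix \<alpha> assume "\<alpha> \<in> L_ideal lt (Ibar lt I)"
    then obtain f where f: "f \<in> Ibar lt I" "f \<noteq> 0" "\<alpha> = LM lt f" by (auto simp: L_ideal_def)
    then obtain s where s: "coeff s 0 \<noteq> 0" "s * f \<in> I" by (auto simp: mem_Ibar_iff[OF lt])
    show "\<alpha> \<in> L_ideal lt I"
      unfolding L_ideal_def using s(2) f(3) LM_unit_mult[OF lt s(1) f(2)]
      by (intro CollectI exI[of _ "s * f"]) simp
  qed
  have "I \<subseteq> Ibar lt I"
  proof
    fix f assume "f \<in> I"
    then show "f \<in> Ibar lt I" by (auto simp: mem_Ibar_iff[OF lt] intro!: exI[of _ 1])
  qed
  then show "L_ideal lt I \<subseteq> L_ideal lt (Ibar lt I)" unfolding L_ideal_def by blast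
qed


section \<open>Monomial ideals and standard monomials\<close>

text \<open>
  The polynomials all of whose monomials are multiples of elements of \<open>Z\<close> form an ideal containing the
  generators; conversely each term of such a polynomial is itself a multiple of a generator.
\<close>

lemma mem_monomial_ideal_iff:
  fixes Z :: "'n expo set" and f :: "('n, 'k::field) mpol"
  shows "f \<in> ideal_gen (xpow ` Z) \<longleftrightarrow> (\<forall>\<beta>\<in>supp f. \<exists>\<gamma>. \<exists>\<zeta>\<in>Z. \<beta> = \<gamma> + \<zeta>)"
proof
  let ?U = "{f :: ('n, 'k) mpol. \<forall>\<beta>\<in>supp f. \<exists>\<gamma>. \<exists>\<zeta>\<in>Z. \<beta> = \<gamma> + \<zeta>}"
  have "is_ideal ?U"
    unfolding is_ideal_iff
  proof (intro conjI ballI allI)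
    fix x y assume "x \<in> ?U" "y \<in> ?U"
    then show "x + y \<in> ?U" using keys_add[of x y] by blast
  next
    fix c x assume x: "x \<in> ?U"
    show "c * x \<in> ?U"
    proof safe
      fix \<beta> assume "\<beta> \<in> supp (c * x)"
      then obtain \<delta> \<epsilon> where "\<beta> = \<delta> + \<epsilon>" "\<epsilon> \<in> supp x" using keys_mult[of c x] by blast
      moreover from this x obtain \<gamma> \<zeta> where "\<zeta> \<in> Z" "\<epsilon> = \<gamma> + \<zeta>" by blast
      ultimately have "\<zeta> \<in> Z" "\<beta> = (\<delta> + \<gamma>) + \<zeta>" by (simp_all add: add.assoc)
      then show "\<exists>\<gamma>. \<exists>\<zeta>\<in>Z. \<beta> = \<gamma> + \<zeta>" by blast
    qed
  qed simp
  moreover have "xpow ` Z \<subseteq> ?U" by (auto simp: supp_xpow intro!: exI[of _ 0])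
  ultimately have "ideal_gen (xpow ` Z) \<subseteq> ?U" by (intro ideal_gen_minimal)
  then show "f \<in> ideal_gen (xpow ` Z) \<Longrightarrow> \<forall>\<beta>\<in>supp f. \<exists>\<gamma>. \<exists>\<zeta>\<in>Z. \<beta> = \<gamma> + \<zeta>" by blast
next
  let ?J = "ideal_gen (xpow ` Z) :: ('n, 'k) mpol set"
  assume *: "\<forall>\<beta>\<in>supp f. \<exists>\<gamma>. \<exists>\<zeta>\<in>Z. \<beta> = \<gamma> + \<zeta>"
  have "Poly_Mapping.single \<beta> (coeff f \<beta>) \<in> ?J" if "\<beta> \<in> supp f" for \<beta>
  proof -
    from * that obtain \<gamma> \<zeta> where \<zeta>: "\<zeta> \<in> Z" "\<beta> = \<gamma> + \<zeta>" by blast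
    have "Poly_Mapping.single \<beta> (coeff f \<beta>) = (const (coeff f \<beta>) * xpow \<gamma>) * xpow \<zeta>"
      by (simp add: \<zeta>(2) const_def xpow_def mult_single)
    then show ?thesis
      using is_ideal_mult[OF is_ideal_ideal_gen ideal_gen_superset] \<zeta>(1) by (metis imageI)
  qed
  then show "f \<in> ?J"
    by (subst sum_of_monomials) (intro is_ideal_sum is_ideal_ideal_gen)
qed

lemma mem_monomial_ideal_iff_monomials:
  "f \<in> ideal_gen (xpow ` Z) \<longleftrightarrow>
     (\<forall>\<beta>\<in>supp f. (xpow \<beta> :: ('n, 'k::field) mpol) \<in> ideal_gen (xpow ` Z))"
  for f :: "('n, 'k::field) mpol"
  unfolding mem_monomial_ideal_iff supp_xpow by simp

lemma xpow_mem_var_ideal_power: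
  fixes \<alpha> :: "'n::finite expo"
  assumes "k \<le> (\<Sum>i\<in>UNIV. Poly_Mapping.lookup \<alpha> i)"
  shows "(xpow \<alpha> :: ('n, 'k::field) mpol) \<in> ideal_power var_ideal k"
  using assms
proof (induction k arbitrary: \<alpha>)
  case (Suc k)
  then obtain i where i: "Poly_Mapping.lookup \<alpha> i \<noteq> 0"
    by (metis not_less_eq_eq le0 sum.neutral)
  define \<beta> where "\<beta> = \<alpha> - pvar i"
  have \<alpha>: "\<alpha> = pvar i + \<beta>"
    using i by (intro poly_mapping_eqI)
      (auto simp: \<beta>_def pvar_def lookup_add lookup_minus lookup_single when_def)
  have "(\<Sum>j\<in>UNIV. Poly_Mapping.lookup (pvar i) j) = 1"
    by (simp add: pvar_def lookup_single when_def)
  then have "k \<le> (\<Sum>j\<in>UNIV. Poly_Mapping.lookup \<beta> j)"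
    using Suc.prems by (simp add: \<alpha> lookup_add sum.distrib)
  then have "(xpow \<beta> :: ('n, 'k) mpol) \<in> ideal_power var_ideal k" by (rule Suc.IH)
  moreover have "(xpow (pvar i) :: ('n, 'k) mpol) \<in> var_ideal"
    unfolding var_ideal_def by (rule ideal_gen_superset) simp
  ultimately show ?case
    unfolding \<alpha> xpow_mult_xpow[symmetric] by (auto intro!: ideal_gen_superset)
qed simp

text \<open>
  All monomials of total degree at least \<open>k\<close> lie in the \<open>k\<close>-th power of the maximal ideal, so outside
  \<open>J\<close> every exponent is below \<open>k\<close>.
\<close>

lemma finite_standard_monomials:
  fixes J :: "('n::finite, 'k::field) mpol set"
  assumes "ideal_power var_ideal k \<subseteq> J"
  shows "finite {\<alpha>. xpow \<alpha> \<notin> J}"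
proof -
  let ?M = "{\<alpha> :: 'n expo. (xpow \<alpha> :: ('n, 'k) mpol) \<notin> J}"
  have "Poly_Mapping.lookup \<alpha> i < k" if "\<alpha> \<in> ?M" for \<alpha> i
  proof -
    have "(\<Sum>i\<in>UNIV. Poly_Mapping.lookup \<alpha> i) < k"
      using that assms xpow_mem_var_ideal_power[of k \<alpha>, where 'k = 'k] by fastforce
    moreover have "Poly_Mapping.lookup \<alpha> i \<le> (\<Sum>i\<in>UNIV. Poly_Mapping.lookup \<alpha> i)"
      by (rule member_le_sum) auto
    ultimately show ?thesis by simp
  qed
  then have "Poly_Mapping.lookup ` ?M \<subseteq> PiE UNIV (\<lambda>_. {..<k})" by (auto simp: PiE_def)
  then have "finite (Poly_Mapping.lookup ` ?M)"
    by (rule finite_subset) (auto intro: finite_PiE)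
  then show ?thesis
    by (rule finite_imageD) (auto intro: inj_onI poly_mapping_eqI)
qed

definition restrict_supp :: "'n expo set \<Rightarrow> ('n, 'k::field) mpol \<Rightarrow> ('n, 'k) mpol" where
  "restrict_supp M f = (\<Sum>\<beta>\<in>M. Poly_Mapping.single \<beta> (coeff f \<beta>))"

lemma coeff_restrict_supp:
  "finite M \<Longrightarrow> coeff (restrict_supp M f) \<beta> = (if \<beta> \<in> M then coeff f \<beta> else 0)"
  by (simp add: restrict_supp_def lookup_sum lookup_single when_def)

lemma supp_restrict_supp: "finite M \<Longrightarrow> supp (restrict_supp M f) = supp f \<inter> M"
  by (auto simp: in_keys_iff coeff_restrict_supp split: if_splits)

text \<open>
  This is what allows the algorithm to ignore the coefficients of monomials outside \<open>M\<close>: the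
  discarded part belongs to the monomial ideal.
\<close>

lemma restrict_supp_congruent:
  fixes f :: "('n, 'k::field) mpol"
  assumes "finite M" "M = {\<alpha>. (xpow \<alpha> :: ('n, 'k) mpol) \<notin> ideal_gen (xpow ` Z)}"
  shows "f - restrict_supp M f \<in> ideal_gen (xpow ` Z)"
proof -
  have "supp (f - restrict_supp M f) \<inter> M = {}"
    using assms(1) by (auto simp: in_keys_iff lookup_minus coeff_restrict_supp)
  then show ?thesis
    unfolding mem_monomial_ideal_iff_monomials[of "f - restrict_supp M f"] using assms(2) by blast
qed

lemma LM_restrict_supp:
  assumes "total_ordering lt" "finite M" "f \<noteq> 0" "LM lt f \<in> M"
  shows "restrict_supp M f \<noteq> 0" "LM lt (restrict_supp M f) = LM lt f"
proof -
  have mem: "LM lt f \<in> supp (restrict_supp M f)"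
    using assms LM_props(1)[OF assms(1,3)] by (simp add: supp_restrict_supp)
  then show "restrict_supp M f \<noteq> 0" by auto
  show "LM lt (restrict_supp M f) = LM lt f"
    using LM_props(2)[OF assms(1,3)] by (intro LM_eqI[OF assms(1) mem]) (simp add: supp_restrict_supp assms(2))
qed


section \<open>Spanning sets, echelon forms and leading monomials\<close>

text \<open>
  The reduction argument: subtract from \<open>p\<close> the multiple of a suitable \<open>b j\<close> that cancels the leading term,
  and repeat. The process stops because \<open>M\<close> is finite: the set of monomials of \<open>M\<close> lying at or below
  some monomial of \<open>p\<close> loses the old leading monomial in each step.
\<close>

lemma span_if_LM_covered:
  fixes b :: "'i \<Rightarrow> ('n, 'k::field) mpol" and W :: "('n, 'k) mpol set"
  assumes tot: "total_ordering lt" and M: "finite M" and J: "finite J"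
    and supp: "\<And>p. p \<in> W \<Longrightarrow> supp p \<subseteq> M"
    and diff: "\<And>p j c. p \<in> W \<Longrightarrow> j \<in> J \<Longrightarrow> p - const c * b j \<in> W"
    and cover: "\<And>p. p \<in> W \<Longrightarrow> p \<noteq> 0 \<Longrightarrow> \<exists>j\<in>J. b j \<noteq> 0 \<and> LM lt (b j) = LM lt p"
    and p: "p \<in> W"
  shows "\<exists>c. p = (\<Sum>j\<in>J. const (c j) * b j)"
  using p
proof (induction "card {\<beta>\<in>M. \<exists>\<gamma>\<in>supp p. \<beta> = \<gamma> \<or> lt \<beta> \<gamma>}" arbitrary: p rule: less_induct)
  case less
  show ?case
  proof (cases "p = 0")
    case True
    then show ?thesis by (intro exI[of _ "\<lambda>_. 0"]) (simp add: const_def)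
  next
    case False
    then obtain j where j: "j \<in> J" "b j \<noteq> 0" "LM lt (b j) = LM lt p" using cover less.prems by blast
    let ?\<mu> = "LM lt p"
    define a where "a = coeff p ?\<mu> / coeff (b j) ?\<mu>"
    define q where "q = p - const a * b j"
    have bnz: "coeff (b j) ?\<mu> \<noteq> 0"
      using LM_props(1)[OF tot j(2)] j(3) by (simp add: in_keys_iff)
    have cq: "coeff q \<beta> = coeff p \<beta> - a * coeff (b j) \<beta>" for \<beta>
      by (simp add: q_def lookup_minus coeff_const_mult)
    have below: "lt \<gamma> ?\<mu>" if "\<gamma> \<in> supp q" for \<gamma>
    proof (rule ccontr)
      assume "\<not> lt \<gamma> ?\<mu>"
      then consider "\<gamma> = ?\<mu>" | "lt ?\<mu> \<gamma>" using total_ordering_total[OF tot] by blast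
      then have "coeff q \<gamma> = 0"
      proof cases
        case 1
        then show ?thesis using bnz by (simp add: cq a_def)
      next
        case 2
        then show ?thesis using coeff_above_LM[OF tot, of p \<gamma>] coeff_above_LM[OF tot, of "b j" \<gamma>] j(3) by (simp add: cq)
      qed
      with that show False by (simp add: in_keys_iff)
    qed
    let ?D = "\<lambda>p. {\<beta>\<in>M. \<exists>\<gamma>\<in>supp p. \<beta> = \<gamma> \<or> lt \<beta> \<gamma>}"
    have \<mu>: "?\<mu> \<in> supp p" by (rule LM_props(1)[OF tot False])
    have "?D q \<subseteq> ?D p" using below \<mu> total_ordering_trans[OF tot] by blast
    moreover have "?\<mu> \<in> ?D p" using \<mu> supp[OF less.prems] by blast
    moreover have "?\<mu> \<notin> ?D q"
      using below total_ordering_trans[OF tot] total_ordering_irrefl[OF tot] by blast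
    ultimately have "?D q \<subset> ?D p" by blast
    then have "card (?D q) < card (?D p)" using M by (intro psubset_card_mono) auto
    moreover have "q \<in> W" unfolding q_def by (rule diff[OF less.prems j(1)])
    ultimately obtain c where c: "q = (\<Sum>j\<in>J. const (c j) * b j)" using less.hyps by blast
    let ?d = "\<lambda>i. const (c i) * b i + (if i = j then const a * b i else 0)"
    have "p = q + const a * b j" by (simp add: q_def)
    also have "\<dots> = (\<Sum>i\<in>J. ?d i)"
      using j(1) J by (simp add: sum.distrib c)
    also have "\<dots> = (\<Sum>i\<in>J. const (if i = j then c i + a else c i) * b i)"
      by (intro sum.cong) (auto simp: const_def single_add algebra_simps)
    finally show ?thesis by (intro exI)
  qed
qed

definition row_poly :: "'n expo list \<Rightarrow> 'k::field mat \<Rightarrow> nat \<Rightarrow> ('n, 'k) mpol" where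
  "row_poly ms B i = (\<Sum>j<length ms. const (B $$ (i, j)) * xpow (ms ! j))"

lemma coeff_row_poly:
  assumes "distinct ms" "j < length ms"
  shows "coeff (row_poly ms B i) (ms ! j) = B $$ (i, j)"
proof -
  have "coeff (row_poly ms B i) (ms ! j) = (\<Sum>l<length ms. if l = j then B $$ (i, l) else 0)"
    unfolding row_poly_def lookup_sum const_mult_xpow lookup_single when_def
    using assms by (intro sum.cong) (auto simp: nth_eq_iff_index_eq)
  then show ?thesis using assms(2) by simp
qed

lemma supp_row_poly: "supp (row_poly ms B i) \<subseteq> set ms"
proof -
  have "coeff (row_poly ms B i) \<beta> = 0" if "\<beta> \<notin> set ms" for \<beta>
    unfolding row_poly_def lookup_sum const_mult_xpow lookup_single when_def
    using that by (intro sum.neutral) auto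
  then show ?thesis by (auto simp: in_keys_iff)
qed

lemma mat_mult_xpow_vec:
  assumes "B \<in> carrier_mat nr (length ms)"
  shows "set\<^sub>v (map_mat const B *\<^sub>v vec_of_list (map xpow ms)) = row_poly ms B ` {..<nr}"
proof -
  have "(map_mat const B *\<^sub>v vec_of_list (map xpow ms)) $ i = row_poly ms B i" if "i < nr" for i
    using that assms
    by (auto simp: row_poly_def scalar_prod_def atLeast0LessThan vec_of_list_index intro!: sum.cong)
  then show ?thesis using assms by (auto simp: vec_set_def)
qed

lemma row_poly_mult:
  assumes "P \<in> carrier_mat nr nr" "B \<in> carrier_mat nr (length ms)" "i < nr"
  shows "row_poly ms (P * B) i = (\<Sum>k<nr. const (P $$ (i, k)) * row_poly ms B k)"
proof -
  have const_sum: "const (sum g A) = (\<Sum>x\<in>A. const (g x) :: ('n, 'k) mpol)"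
    for g :: "nat \<Rightarrow> 'k::field" and A
    by (induction A rule: infinite_finite_induct) (simp_all add: const_def single_add)
  have const_mult: "const (a * b) = (const a * const b :: ('n, 'k) mpol)" for a b :: "'k::field"
    by (simp add: const_def mult_single)
  have "row_poly ms (P * B) i =
      (\<Sum>j<length ms. \<Sum>k<nr. const (P $$ (i, k)) * (const (B $$ (k, j)) * xpow (ms ! j)))"
    unfolding row_poly_def using assms
    by (intro sum.cong)
      (auto simp: scalar_prod_def atLeast0LessThan const_sum const_mult sum_distrib_right mult.assoc)
  also have "\<dots> = (\<Sum>k<nr. const (P $$ (i, k)) * row_poly ms B k)"
    unfolding row_poly_def by (subst sum.swap) (simp add: sum_distrib_left)
  finally show ?thesis .
qed

text \<open>
  Because the columns are decreasing, the leading monomial of \<open>p\<close> sits in the first column \<open>j\<close> where the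
  coefficient vector of \<open>p\<close> is nonzero. Some row \<open>i\<close> with \<open>c i \<noteq> 0\<close> is nonzero in column \<open>j\<close>, so its pivot
  is at or before \<open>j\<close>. In its pivot column all other rows vanish, hence \<open>p\<close> has the coefficient \<open>c i\<close>
  there, and the pivot cannot come before \<open>j\<close>.
\<close>

lemma LM_row_space_echelon:
  fixes p :: "('n, 'k::field) mpol"
  assumes tot: "total_ordering lt"
    and sorted: "sorted_wrt (\<lambda>\<alpha> \<beta>. lt \<beta> \<alpha>) ms"
    and B: "B \<in> carrier_mat nr (length ms)" and ref: "row_echelon_form B"
    and p: "p = (\<Sum>i<nr. const (c i) * row_poly ms B i)" and p0: "p \<noteq> 0"
  shows "\<exists>i<nr. row_poly ms B i \<noteq> 0 \<and> LM lt (row_poly ms B i) = LM lt p"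
proof -
  have dec: "lt (ms ! j) (ms ! i)" if "i < j" "j < length ms" for i j
    using sorted that by (simp add: sorted_wrt_iff_nth_less)
  have dist: "distinct ms"
    unfolding distinct_conv_nth
    using dec total_ordering_irrefl[OF tot] by (metis nat_neq_iff)
  have cp: "coeff p (ms ! j) = (\<Sum>i<nr. c i * B $$ (i, j))" if "j < length ms" for j
    using that by (simp add: p lookup_sum coeff_const_mult coeff_row_poly[OF dist])
  have "coeff p \<beta> = 0" if "\<beta> \<notin> set ms" for \<beta>
  proof -
    have "coeff (row_poly ms B i) \<beta> = 0" for i
      using that supp_row_poly[of ms B i] by (auto simp: in_keys_iff)
    then show ?thesis by (simp add: p lookup_sum coeff_const_mult)
  qed
  then have "LM lt p \<in> set ms" using LM_props(1)[OF tot p0] by (auto simp: in_keys_iff)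
  then obtain j where j: "j < length ms" "ms ! j = LM lt p" by (auto simp: in_set_conv_nth)
  have "(\<Sum>i<nr. c i * B $$ (i, j)) \<noteq> 0"
    using LM_props(1)[OF tot p0] cp[OF j(1)] j(2) by (simp add: in_keys_iff)
  then obtain i where i: "i < nr" "c i * B $$ (i, j) \<noteq> 0" by (meson lessThan_iff sum.neutral)
  obtain f where "pivot_fun B f (length ms)" using ref B by (auto simp: row_echelon_form_def)
  note piv = pivot_funD[OF _ this, of nr]
  have "f i \<le> j" using piv(2)[of i j] i B by force
  moreover have "\<not> f i < j"
  proof
    assume lt: "f i < j"
    have "coeff p (ms ! f i) = (\<Sum>i'<nr. if i' = i then c i' else 0)"
      unfolding cp[OF less_trans[OF lt j(1)]]
      using piv(4)[of i] piv(5)[of i] i B lt j(1) by (intro sum.cong) auto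
    then have "coeff p (ms ! f i) \<noteq> 0" using i by simp
    then show False using coeff_above_LM[OF tot, of p "ms ! f i"] dec[OF lt j(1)] j(2) by simp
  qed
  ultimately have fi: "f i = j" by simp
  have mem: "LM lt p \<in> supp (row_poly ms B i)"
    using i j coeff_row_poly[OF dist j(1), of B i] by (auto simp: in_keys_iff)
  moreover have "LM lt (row_poly ms B i) = LM lt p"
  proof (rule LM_eqI[OF tot mem])
    fix \<beta> assume \<beta>: "\<beta> \<in> supp (row_poly ms B i)" "\<beta> \<noteq> LM lt p"
    then obtain l where l: "l < length ms" "\<beta> = ms ! l"
      using supp_row_poly by (metis in_set_conv_nth subsetD)
    then have "B $$ (i, l) \<noteq> 0" using \<beta>(1) coeff_row_poly[OF dist l(1), of B i] by (simp add: in_keys_iff)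
    then have "j \<le> l" using piv(2)[of i l] i(1) B fi by force
    moreover have "l \<noteq> j" using \<beta>(2) l(2) j(2) by auto
    ultimately show "lt \<beta> (LM lt p)" using dec[of j l] l j(2) by simp
  qed
  ultimately show ?thesis using i(1) by (intro exI[of _ i]) auto
qed


section \<open>Runs of the algorithm\<close>

text \<open>
  Both inclusions between the row spaces: the echelon form is \<open>P * A\<close> for an invertible matrix \<open>P\<close>.
\<close>

lemma gauss_jordan_row_space:
  fixes A :: "'k::field mat"
  assumes A: "A \<in> carrier_mat nr (length ms)"
  shows "\<exists>P. \<forall>i<nr. row_poly ms (gauss_jordan_single A) i =
           (\<Sum>k<nr. const (P i k) * row_poly ms A k)"
    and "\<exists>d. (\<Sum>k<nr. const (c k) * row_poly ms A k) =
           (\<Sum>i<nr. const (d i) * row_poly ms (gauss_jordan_single A) i)"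
proof -
  let ?C = "gauss_jordan_single A"
  note C = gauss_jordan_single(2)[OF A refl]
  obtain P Q where PQ: "?C = P * A" "P \<in> carrier_mat nr nr" "Q \<in> carrier_mat nr nr" "Q * P = 1\<^sub>m nr"
    using gauss_jordan_single(4)[OF A refl] by blast
  have "A = (Q * P) * A" using PQ(4) A by simp
  also have "\<dots> = Q * ?C" unfolding PQ(1) by (rule assoc_mult_mat[OF PQ(3,2) A])
  finally have QC: "A = Q * ?C" .
  show "\<exists>P. \<forall>i<nr. row_poly ms ?C i = (\<Sum>k<nr. const (P i k) * row_poly ms A k)"
    using row_poly_mult[OF PQ(2) A] PQ(1) by (intro exI[of _ "\<lambda>i k. P $$ (i, k)"]) simp
  \<comment> \<open>The coefficient vector \<open>c\<close> is repeated in every row so that the rule for square matrices applies;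
     only row \<open>0\<close> of the product is read off.\<close>
  let ?v = "mat nr nr (\<lambda>(i, k). c k)"
  show "\<exists>d. (\<Sum>k<nr. const (c k) * row_poly ms A k) = (\<Sum>i<nr. const (d i) * row_poly ms ?C i)"
  proof (cases "nr = 0")
    case False
    have "?v * A = ?v * (Q * ?C)" by (rule arg_cong[OF QC])
    also have "\<dots> = (?v * Q) * ?C" by (rule assoc_mult_mat[symmetric, of _ nr nr, OF _ PQ(3) C]) simp
    finally have eq: "?v * A = (?v * Q) * ?C" .
    have "(\<Sum>k<nr. const (c k) * row_poly ms A k) = row_poly ms (?v * A) 0"
      using False by (subst row_poly_mult[OF _ A]) auto
    also have "\<dots> = (\<Sum>i<nr. const ((?v * Q) $$ (0, i)) * row_poly ms ?C i)"
      unfolding eq using False PQ(3) by (subst row_poly_mult[OF _ C]) auto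
    finally show ?thesis by (rule exI[of _ "\<lambda>i. (?v * Q) $$ (0, i)"])
  qed simp
qed

lemma exists_sorted_list:
  fixes lt :: "'n mord"
  assumes tot: "total_ordering lt" and "finite M"
  shows "\<exists>ms. sorted_wrt (\<lambda>\<alpha> \<beta>. lt \<beta> \<alpha>) ms \<and> set ms = M"
  using assms(2)
proof (induction rule: finite_induct)
  case (insert a M)
  then obtain ms where c: "sorted_wrt (\<lambda>\<alpha> \<beta>. lt \<beta> \<alpha>) ms" "set ms = M" by blast
  let ?cs = "filter (\<lambda>\<beta>. lt a \<beta>) ms @ a # filter (\<lambda>\<beta>. lt \<beta> a) ms"
  have "set ?cs = insert a M"
    using c(2) insert(2) total_ordering_total[OF tot] by auto
  moreover have "sorted_wrt (\<lambda>\<alpha> \<beta>. lt \<beta> \<alpha>) ?cs"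
    using c(1) total_ordering_trans[OF tot]
    by (auto simp: sorted_wrt_append sorted_wrt_filter)
  ultimately show ?case by blast
qed simp

lemma find_SomeD: "find P xs = Some x \<Longrightarrow> x \<in> set xs \<and> P x"
  by (auto simp: find_Some_iff)

text \<open>
  The columns can be listed because \<open>M\<close> is finite, and each search for an element of \<open>G\<close> succeeds
  because \<open>H\<close> consists of leading monomials of monomial multiples of elements of \<open>G\<close>.
\<close>

lemma standard_basis_change_run_exists:
  fixes I :: "('n::{finite,linorder}, 'k::field) mpol set" and G :: "('n, 'k) mpol list"
  assumes lt: "local_ordering TYPE('k) lt" and lt2: "local_ordering TYPE('k) lt2"
    and Z: "valid_Zgen lt I (computeZgen G lt)"
  shows "\<exists>R. standard_basis_change computeZgen G lt lt2 R"
proof -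
  define M where "M = {\<alpha>. (xpow \<alpha> :: ('n, 'k) mpol) \<notin> ideal_gen (xpow ` computeZgen G lt)}"
  define H where "H = M - {\<alpha>\<in>M. \<alpha> \<notin> L_gens lt (set G)}"
  have "\<exists>k. ideal_power (var_ideal :: ('n, 'k) mpol set) k \<subseteq> ideal_gen (xpow ` computeZgen G lt)"
    using Z unfolding valid_Zgen_def by simp
  then obtain k where "ideal_power (var_ideal :: ('n, 'k) mpol set) k \<subseteq> ideal_gen (xpow ` computeZgen G lt)" ..
  then have M: "finite M" unfolding M_def by (rule finite_standard_monomials)
  obtain ms where ms: "sorted_wrt (\<lambda>\<alpha> \<beta>. lt2 \<beta> \<alpha>) ms" "set ms = M"
    using exists_sorted_list[OF local_ordering_total[OF lt2] M] by blast
  have "\<exists>g \<theta>. find (\<lambda>g. g \<noteq> 0 \<and> (\<exists>\<theta>\<in>terms. LM lt (\<theta> * g) = \<alpha>)) G = Some g \<and>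
          \<theta> \<in> terms \<and> LM lt (\<theta> * g) = \<alpha>" if \<alpha>: "\<alpha> \<in> H" for \<alpha>
  proof -
    let ?P = "\<lambda>g :: ('n, 'k) mpol. g \<noteq> 0 \<and> (\<exists>\<theta>\<in>terms. LM lt (\<theta> * g) = \<alpha>)"
    obtain \<beta> g where g: "g \<in> set G" "g \<noteq> 0" "\<alpha> = LM lt (xpow \<beta> * g)"
      using \<alpha> unfolding H_def L_gens_def by blast
    have "(xpow \<beta> :: ('n, 'k) mpol) \<in> terms"
      unfolding terms_def by (rule CollectI, intro exI[of _ 1] exI[of _ \<beta>]) (simp add: const_def)
    then have "find ?P G \<noteq> None" using g by (auto simp: find_None_iff)
    then obtain h where "find ?P G = Some h" by blast
    moreover from this have "?P h" by (auto simp: find_Some_iff)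
    ultimately show ?thesis by blast
  qed
  then have "\<forall>\<alpha>\<in>H. \<exists>g \<theta>. find (\<lambda>g. g \<noteq> 0 \<and> (\<exists>\<theta>\<in>terms. LM lt (\<theta> * g) = \<alpha>)) G = Some g \<and>
          \<theta> \<in> terms \<and> LM lt (\<theta> * g) = \<alpha>" by blast
  from bchoice[OF this] obtain f where
    "\<forall>\<alpha>\<in>H. \<exists>\<theta>. find (\<lambda>g. g \<noteq> 0 \<and> (\<exists>\<theta>\<in>terms. LM lt (\<theta> * g) = \<alpha>)) G = Some (f \<alpha>) \<and>
          \<theta> \<in> terms \<and> LM lt (\<theta> * f \<alpha>) = \<alpha>" by blast
  from bchoice[OF this] obtain \<eta> where f: "\<forall>\<alpha>\<in>H. find (\<lambda>g. g \<noteq> 0 \<and> (\<exists>\<theta>\<in>terms. LM lt (\<theta> * g) = \<alpha>)) G = Some (f \<alpha>) \<and>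
          \<eta> \<alpha> \<in> terms \<and> LM lt (\<eta> \<alpha> * f \<alpha>) = \<alpha>" by blast
  obtain rows where "distinct rows" "set rows = (\<lambda>\<alpha>. \<eta> \<alpha> * f \<alpha>) ` H"
    using finite_distinct_list[of "(\<lambda>\<alpha>. \<eta> \<alpha> * f \<alpha>) ` H"] M by (auto simp: H_def)
  with f ms show ?thesis
    unfolding standard_basis_change_def Let_def M_def[symmetric] H_def[symmetric] by blast
qed

text \<open>
  The argument takes place in the closure of \<open>I\<close>, where the truncated rows live. The ordering \<open>\<prec>\<close> serves to show
  that these rows span the part of the closure supported on \<open>M\<close>, and \<open>\<prec>\<^sub>2\<close> to read off leading
  monomials from the echelon form.
\<close>

lemma standard_basis_change_correct:
  fixes I :: "('n::{finite,linorder}, 'k::field) mpol set"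
  assumes I: "is_ideal I"
    and lt: "local_ordering TYPE('k) lt" and lt2: "local_ordering TYPE('k) lt2"
    and G: "standard_basis lt I (set G)"
    and Z: "valid_Zgen lt I (computeZgen G lt)"
    and run: "standard_basis_change computeZgen G lt lt2 R"
  shows "standard_basis lt2 I R"
proof -
  note tot = local_ordering_total[OF lt] and tot2 = local_ordering_total[OF lt2]
  let ?Ib = "Ibar lt I" and ?Z = "computeZgen G lt"
  note Ib = is_ideal_Ibar[OF lt I]
  define M where "M = {\<alpha>. (xpow \<alpha> :: ('n, 'k) mpol) \<notin> ideal_gen (xpow ` ?Z)}"
  define H where "H = M - {\<alpha>\<in>M. \<alpha> \<notin> L_gens lt (set G)}"
  obtain f \<eta> rows ms where
    f: "\<forall>\<alpha>\<in>H. find (\<lambda>g. g \<noteq> 0 \<and> (\<exists>\<theta>\<in>terms. LM lt (\<theta> * g) = \<alpha>)) G = Some (f \<alpha>) \<and>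
          \<eta> \<alpha> \<in> terms \<and> LM lt (\<eta> \<alpha> * f \<alpha>) = \<alpha>"
    and rows: "set rows = (\<lambda>\<alpha>. \<eta> \<alpha> * f \<alpha>) ` H"
    and ms: "sorted_wrt (\<lambda>\<alpha> \<beta>. lt2 \<beta> \<alpha>) ms" "set ms = M"
    and R: "R = set\<^sub>v (map_mat const (gauss_jordan_single (mat (length rows) (length ms)
              (\<lambda>(i, j). coeff (rows ! i) (ms ! j)))) *\<^sub>v vec_of_list (map xpow ms)) \<union> xpow ` ?Z"
    using run unfolding standard_basis_change_def Let_def M_def[symmetric] H_def[symmetric] by blast
  define nr where "nr = length rows"
  define A where "A = mat nr (length ms) (\<lambda>(i, j). coeff (rows ! i) (ms ! j))"
  define C where "C = gauss_jordan_single A"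
  have A: "A \<in> carrier_mat nr (length ms)" by (simp add: A_def)
  have C: "C \<in> carrier_mat nr (length ms)" "row_echelon_form C"
    using gauss_jordan_single(2,3)[OF A C_def[symmetric]] by auto
  have R': "R = row_poly ms C ` {..<nr} \<union> xpow ` ?Z"
    using R mat_mult_xpow_vec[OF C(1)] unfolding C_def A_def nr_def by simp
  have finM: "finite M" using ms(2) by auto
  have dist: "distinct ms"
    using ms(1) total_ordering_irrefl[OF tot2] unfolding distinct_conv_nth
    by (metis nat_neq_iff sorted_wrt_iff_nth_less)
  have GIb: "set G \<subseteq> ?Ib" and LG: "L_gens lt (set G) = L_ideal lt ?Ib"
    using G L_ideal_Ibar[OF lt] by (auto simp: standard_basis_def)
  have ZIb: "ideal_gen (xpow ` ?Z) \<subseteq> ?Ib" and finZ: "finite ?Z"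
    using Z unfolding valid_Zgen_def by simp_all
  have congr: "restrict_supp M g \<in> ?Ib" if "g \<in> ?Ib" for g
  proof -
    have "g - (g - restrict_supp M g) \<in> ?Ib"
      using restrict_supp_congruent[OF finM M_def, of g] ZIb that is_ideal_diff[OF Ib] by blast
    then show ?thesis by simp
  qed
  have rowA: "row_poly ms A k = restrict_supp M (rows ! k)" if "k < nr" for k
  proof (rule poly_mapping_eqI)
    fix \<beta>
    show "coeff (row_poly ms A k) \<beta> = coeff (restrict_supp M (rows ! k)) \<beta>"
    proof (cases "\<beta> \<in> M")
      case True
      then obtain j where "j < length ms" "\<beta> = ms ! j" using ms(2) by (auto simp: in_set_conv_nth)
      then show ?thesis
        using True that by (simp add: coeff_row_poly[OF dist] coeff_restrict_supp[OF finM] A_def)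
    next
      case False
      then show ?thesis
        using supp_row_poly[of ms A k] ms(2) by (auto simp: coeff_restrict_supp[OF finM] in_keys_iff)
    qed
  qed
  have chosen: "f \<alpha> \<in> set G" "f \<alpha> \<noteq> 0" "\<eta> \<alpha> \<in> terms" "LM lt (\<eta> \<alpha> * f \<alpha>) = \<alpha>"
    if "\<alpha> \<in> H" for \<alpha>
  proof -
    note f\<alpha> = bspec[OF f that]
    show "\<eta> \<alpha> \<in> terms" "LM lt (\<eta> \<alpha> * f \<alpha>) = \<alpha>" using f\<alpha> by simp_all
    show "f \<alpha> \<in> set G" "f \<alpha> \<noteq> 0" using find_SomeD[OF conjunct1[OF f\<alpha>]] by simp_all
  qed
  have rows_Ib: "rows ! k \<in> ?Ib" if "k < nr" for k
  proof -
    have "rows ! k \<in> (\<lambda>\<alpha>. \<eta> \<alpha> * f \<alpha>) ` H" using that rows nth_mem[of k rows] by (simp add: nr_def)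
    then obtain \<alpha> where \<alpha>: "\<alpha> \<in> H" "rows ! k = \<eta> \<alpha> * f \<alpha>" by (rule imageE)
    show ?thesis unfolding \<alpha>(2) by (rule is_ideal_mult[OF Ib subsetD[OF GIb chosen(1)[OF \<alpha>(1)]]])
  qed
  have rowA_Ib: "row_poly ms A k \<in> ?Ib" if "k < nr" for k
    using that by (simp add: rowA congr rows_Ib)
  have rowC_Ib: "row_poly ms C i \<in> ?Ib" if "i < nr" for i
  proof -
    obtain P where "\<forall>i<nr. row_poly ms C i = (\<Sum>k<nr. const (P i k) * row_poly ms A k)"
      using gauss_jordan_row_space(1)[OF A] unfolding C_def by blast
    then show ?thesis
      using that rowA_Ib by (auto intro!: is_ideal_sum[OF Ib] is_ideal_mult[OF Ib])
  qed
  have RIb: "R \<subseteq> ?Ib"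
    unfolding R' using rowC_Ib ZIb ideal_gen_superset[of _ "xpow ` ?Z"] by blast
  \<comment> \<open>Here the standard basis property of \<open>G\<close> enters: \<open>LM p\<close> lies in \<open>L(G)\<close> and in \<open>M\<close>, so it is in \<open>H\<close>
     and a row was chosen for it. That row keeps its leading monomial under truncation to \<open>M\<close>.\<close>
  have rows_cover: "\<exists>k<nr. row_poly ms A k \<noteq> 0 \<and> LM lt (row_poly ms A k) = LM lt p"
    if p: "p \<in> ?Ib" "supp p \<subseteq> M" "p \<noteq> 0" for p
  proof -
    have "LM lt p \<in> L_gens lt (set G)" unfolding LG L_ideal_def using p by blast
    moreover have "LM lt p \<in> M" using LM_props(1)[OF tot p(3)] p(2) by blast
    ultimately have \<alpha>: "LM lt p \<in> H" by (simp add: H_def)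
    let ?\<alpha> = "LM lt p"
    let ?r = "\<eta> ?\<alpha> * f ?\<alpha>"
    have "?r \<in> set rows" using \<alpha> rows by blast
    then obtain k where k: "k < nr" "rows ! k = ?r" unfolding nr_def by (auto simp: in_set_conv_nth)
    have "f ?\<alpha> \<noteq> 0" by (rule chosen(2)[OF \<alpha>])
    moreover have "\<eta> ?\<alpha> \<noteq> 0"
    proof -
      obtain c \<beta> where "\<eta> ?\<alpha> = Poly_Mapping.single \<beta> c" "c \<noteq> 0"
        using chosen(3)[OF \<alpha>] unfolding terms_def const_mult_xpow by (elim CollectE exE conjE) auto
      then show ?thesis by (metis lookup_single_eq lookup_zero)
    qed
    ultimately have r0: "?r \<noteq> 0" by simp
    have "LM lt ?r = ?\<alpha>" by (rule chosen(4)[OF \<alpha>])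
    then show ?thesis
      using LM_restrict_supp[OF tot finM r0] \<alpha> k rowA[OF k(1)] by (auto simp: H_def)
  qed
  have Ib_span: "\<exists>d. p = (\<Sum>i<nr. const (d i) * row_poly ms C i)"
    if p: "p \<in> ?Ib" "supp p \<subseteq> M" for p
  proof -
    have "\<exists>c. p = (\<Sum>k\<in>{..<nr}. const (c k) * row_poly ms A k)"
    proof (rule span_if_LM_covered[OF tot finM, where W = "{p \<in> ?Ib. supp p \<subseteq> M}"])
      fix q k c assume q: "q \<in> {p \<in> ?Ib. supp p \<subseteq> M}" and k: "k \<in> {..<nr}"
      have "supp (q - const c * row_poly ms A k) \<subseteq> M"
      proof
        fix \<beta> assume "\<beta> \<in> supp (q - const c * row_poly ms A k)"
        then have "\<beta> \<in> supp q \<or> \<beta> \<in> supp (row_poly ms A k)"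
          by (auto simp: in_keys_iff lookup_minus coeff_const_mult)
        then show "\<beta> \<in> M" using q supp_row_poly[of ms A k] ms(2) by blast
      qed
      moreover have "q - const c * row_poly ms A k \<in> ?Ib"
        using q k rowA_Ib is_ideal_mult[OF Ib] by (intro is_ideal_diff[OF Ib]) auto
      ultimately show "q - const c * row_poly ms A k \<in> {p \<in> ?Ib. supp p \<subseteq> M}" by blast
    next
      fix q assume "q \<in> {p \<in> ?Ib. supp p \<subseteq> M}" "q \<noteq> 0"
      then show "\<exists>k\<in>{..<nr}. row_poly ms A k \<noteq> 0 \<and> LM lt (row_poly ms A k) = LM lt q"
        using rows_cover[of q] by blast
    qed (use p in auto)
    then obtain c where "p = (\<Sum>k<nr. const (c k) * row_poly ms A k)" by blast
    then show ?thesis using gauss_jordan_row_space(2)[OF A, of c] unfolding C_def by simp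
  qed
  have LI: "L_ideal lt2 I = L_ideal lt2 ?Ib"
    using L_ideal_Ibar[OF lt2, of I] Ibar_local_ordering_indep[OF lt lt2] by simp
  have "L_gens lt2 R \<subseteq> L_ideal lt2 ?Ib"
  proof
    fix \<alpha> assume "\<alpha> \<in> L_gens lt2 R"
    then obtain \<beta> g where g: "g \<in> R" "g \<noteq> 0" "\<alpha> = LM lt2 (xpow \<beta> * g)" by (auto simp: L_gens_def)
    then have "xpow \<beta> * g \<in> ?Ib" using RIb is_ideal_mult[OF Ib] by blast
    moreover have "xpow \<beta> * g \<noteq> 0" using g(2) xpow_nonzero by simp
    ultimately show "\<alpha> \<in> L_ideal lt2 ?Ib" using g(3) unfolding L_ideal_def by blast
  qed
  moreover have "L_ideal lt2 ?Ib \<subseteq> L_gens lt2 R"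
  proof
    fix \<alpha> assume "\<alpha> \<in> L_ideal lt2 ?Ib"
    then obtain g where g: "g \<in> ?Ib" "g \<noteq> 0" "\<alpha> = LM lt2 g" by (auto simp: L_ideal_def)
    show "\<alpha> \<in> L_gens lt2 R"
    proof (cases "\<alpha> \<in> M")
      case False
      then have "(xpow \<alpha> :: ('n, 'k) mpol) \<in> ideal_gen (xpow ` ?Z)" by (simp add: M_def)
      then obtain \<gamma> \<zeta> where \<zeta>: "\<zeta> \<in> ?Z" "\<alpha> = \<gamma> + \<zeta>"
        unfolding mem_monomial_ideal_iff by (auto simp: supp_xpow)
      then have "\<alpha> = LM lt2 (xpow \<gamma> * xpow \<zeta> :: ('n, 'k) mpol)"
        by (simp add: xpow_mult_xpow LM_xpow[OF tot2])
      moreover have "(xpow \<zeta> :: ('n, 'k) mpol) \<in> R" using \<zeta> R' by blast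
      ultimately show ?thesis unfolding L_gens_def using xpow_nonzero by blast
    next
      case True
      note r = LM_restrict_supp[OF tot2 finM g(2) True[unfolded g(3)]]
      obtain d where "restrict_supp M g = (\<Sum>i<nr. const (d i) * row_poly ms C i)"
        using Ib_span[OF congr[OF g(1)]] by (auto simp: supp_restrict_supp[OF finM])
      from LM_row_space_echelon[OF tot2 ms(1) C this r(1)]
      obtain i where i: "i < nr" "row_poly ms C i \<noteq> 0" "LM lt2 (row_poly ms C i) = \<alpha>"
        using r(2) g(3) by auto
      have "\<alpha> = LM lt2 (xpow 0 * row_poly ms C i)" using i(3) by (simp add: xpow_def)
      moreover have "row_poly ms C i \<in> R" using i(1) R' by blast
      ultimately show ?thesis unfolding L_gens_def using i(2) by blast
    qed
  qed
  moreover have "finite R" using R' finZ by simp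
  ultimately show ?thesis
    unfolding standard_basis_def LI using RIb Ibar_local_ordering_indep[OF lt lt2] by blast
qed

theorem proposition4p4:
  fixes I :: "('n::{finite,linorder}, 'k::field) mpol set"
    and G :: "('n, 'k) mpol list"
    and lt lt2 :: "'n mord"
    and computeZgen :: "('n, 'k) mpol list \<Rightarrow> 'n mord \<Rightarrow> 'n expo set"
  assumes "is_ideal I"
    and "zero_dimensional I"
    and "local_ordering TYPE('k) lt"
    and "local_ordering TYPE('k) lt2"
    and "standard_basis lt I (set G)"
    and "valid_Zgen lt I (computeZgen G lt)"
  shows "(\<exists>R. standard_basis_change computeZgen G lt lt2 R) \<and>
         (\<forall>R. standard_basis_change computeZgen G lt lt2 R \<longrightarrow> standard_basis lt2 I R)"
proof (intro conjI allI impI)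
  show "\<exists>R. standard_basis_change computeZgen G lt lt2 R"
    using assms(3,4,6) by (rule standard_basis_change_run_exists)
  show "standard_basis lt2 I R" if "standard_basis_change computeZgen G lt lt2 R" for R
    using assms(1,3-6) that by (rule standard_basis_change_correct)
qed

end
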